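(* Let $\mathbb{K}$ be a field of characteristic zero, let $m\ge1$ and let $k\le 2m+1$ be a positive integer. Then the following polynomials are identities for $F_k(UT_2(G))$: (1) $[x_1,x_2,x_3][x_4,x_5,x_6]$; (2) $[x_1,x_2,x_3][x_4,x_5]\cdots[x_{2m+4},x_{2m+5}]$; (3) $[x_1,x_2]\cdots[x_{2m+1},x_{2m+2}][x_{2m+3},x_{2m+4},x_{2m+5}]$; (4) $[x_1,x_2]\cdots[x_{4m+3},x_{4m+4}]$.
   Context: $G$ is the (unital) Grassmann algebra of a countably infinite dimensional $\mathbb{K}$-vector space, and $UT_2(G)$ is the algebra of $2\times2$ upper triangular matrices over $G$. For a unital associative algebra $A$, $T(A)$ is the ideal of all polynomial identities of $A$ in the free unital associative algebra $\mathbb{K}\langle x_1,x_2,\dots\rangle$, and $F_k(A)=\mathbb{K}\langle x_1,\dots,x_k\rangle/(T(A)\cap\mathbb{K}\langle x_1,\dots,x_k\rangle)$ is the relatively free algebra of rank $k$ of the variety generated by $A$. Commutators are $[a,b]=ab-ba$ and are left-normed: $[a,b,c]=[[a,b],c]$. In (2), the triple commutator is followed by $m+1$ commutators of length 2; in (3), it is preceded by $m+1$ such commutators; (4) is a product of $2m+2$ commutators of length 2, all in distinct, consecutively indexed variables. *)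

theory Defs
  imports
    "HOL-Library.Poly_Mapping"
    "HOL-Analysis.Finite_Cartesian_Product"
    "HOL-Algebra.QuotRing"
    "HOL-Algebra.Module"
begin

section \<open>Free unital associative algebras\<close>

datatype 'x word = Word (letters: "'x list")

instantiation word :: (type) monoid_add
begin

definition zero_word :: "'a word" where
  "0 = Word []"

definition plus_word :: "'a word \<Rightarrow> 'a word \<Rightarrow> 'a word" where
  "u + v = Word (letters u @ letters v)"

instance
  by standard (simp_all add: zero_word_def plus_word_def)

end

text \<open>The monoid algebra of the free monoid; its product is convolution, hence in general
  not commutative.\<close>

type_synonym ('x, 'k) ncpoly = "'x word \<Rightarrow>\<^sub>0 'k"

definition var :: "'x \<Rightarrow> ('x, 'k::field) ncpoly" where
  "var i = Poly_Mapping.single (Word [i]) 1"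

text \<open>Unital associative algebras over a field of type \<open>'k\<close> are represented by the record type
  \<^type>\<open>module\<close>, which has ring operations together with a scalar multiplication.\<close>

definition free_algebra :: "'x set \<Rightarrow> ('k::field, ('x, 'k) ncpoly) module" where
  "free_algebra V =
     \<lparr>carrier = {f. \<forall>w \<in> Poly_Mapping.keys f. set (letters w) \<subseteq> V},
      mult = (*), one = 1, zero = 0, add = (+),
      smult = (\<lambda>c f. Poly_Mapping.single 0 c * f)\<rparr>"

section \<open>Quotient algebras\<close>

definition quot_algebra :: "('k, 'a, 'e) module_scheme \<Rightarrow> 'a set \<Rightarrow> ('k, 'a set) module" where
  "quot_algebra A I =
     \<lparr>carrier = carrier (A Quot I), mult = mult (A Quot I), one = one (A Quot I),
      zero = zero (A Quot I), add = add (A Quot I),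
      smult = (\<lambda>c X. \<Union>x\<in>X. I +>\<^bsub>A\<^esub> (c \<odot>\<^bsub>A\<^esub> x))\<rparr>"

section \<open>Polynomial identities and relatively free algebras\<close>

definition eval_word :: "('k, 'a, 'e) module_scheme \<Rightarrow> ('x \<Rightarrow> 'a) \<Rightarrow> 'x word \<Rightarrow> 'a" where
  "eval_word A a w = foldr (\<lambda>i p. a i \<otimes>\<^bsub>A\<^esub> p) (letters w) \<one>\<^bsub>A\<^esub>"

definition eval_poly ::
    "('k::field, 'a, 'e) module_scheme \<Rightarrow> ('x \<Rightarrow> 'a) \<Rightarrow> ('x, 'k) ncpoly \<Rightarrow> 'a" where
  "eval_poly A a f =
     (\<Oplus>\<^bsub>A\<^esub>w\<in>Poly_Mapping.keys f. Poly_Mapping.lookup f w \<odot>\<^bsub>A\<^esub> eval_word A a w)"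

text \<open>The variables are \<open>x\<^sub>1, x\<^sub>2, \<dots>\<close>; the index 0 is not used.\<close>

definition polynomial_identity ::
    "('k::field, 'a, 'e) module_scheme \<Rightarrow> (nat, 'k) ncpoly \<Rightarrow> bool" where
  "polynomial_identity A f \<longleftrightarrow>
     f \<in> carrier (free_algebra {1..}) \<and>
     (\<forall>a \<in> {1..} \<rightarrow> carrier A. eval_poly A a f = \<zero>\<^bsub>A\<^esub>)"

definition T_ideal :: "('k::field, 'a, 'e) module_scheme \<Rightarrow> (nat, 'k) ncpoly set" where
  "T_ideal A = {f. polynomial_identity A f}"

definition rel_free_algebra ::
    "nat \<Rightarrow> ('k::field, 'a, 'e) module_scheme \<Rightarrow> ('k, (nat, 'k) ncpoly set) module" where
  "rel_free_algebra k A =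
     quot_algebra (free_algebra {1..k}) (T_ideal A \<inter> carrier (free_algebra {1..k}))"

section \<open>The Grassmann algebra and upper triangular matrices\<close>

text \<open>The exterior algebra of the vector space \<open>V\<close> with basis \<open>e\<^sub>0, e\<^sub>1, \<dots>\<close>: the tensor algebra
  of \<open>V\<close>, which is the free algebra on the basis, modulo the ideal generated by the squares
  of the elements of \<open>V\<close>. These elements are the polynomials all of whose monomials have
  length 1.\<close>

definition grassmann :: "('k::field, (nat, 'k) ncpoly set) module" where
  "grassmann =
     quot_algebra (free_algebra UNIV)
       (Idl\<^bsub>free_algebra UNIV\<^esub> {v * v | v. \<forall>w \<in> Poly_Mapping.keys v. length (letters w) = 1})"

definition UT2 :: "('k, 'a, 'e) module_scheme \<Rightarrow> ('k, 'a ^ 2 ^ 2) module" where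
  "UT2 A =
     \<lparr>carrier = {M. (\<forall>i j. M $ i $ j \<in> carrier A) \<and> M $ 2 $ 1 = \<zero>\<^bsub>A\<^esub>},
      mult = (\<lambda>M N. \<chi> i j. \<Oplus>\<^bsub>A\<^esub>l\<in>UNIV. M $ i $ l \<otimes>\<^bsub>A\<^esub> N $ l $ j),
      one = (\<chi> i j. if i = j then \<one>\<^bsub>A\<^esub> else \<zero>\<^bsub>A\<^esub>),
      zero = (\<chi> i j. \<zero>\<^bsub>A\<^esub>),
      add = (\<lambda>M N. \<chi> i j. M $ i $ j \<oplus>\<^bsub>A\<^esub> N $ i $ j),
      smult = (\<lambda>c M. \<chi> i j. c \<odot>\<^bsub>A\<^esub> M $ i $ j)\<rparr>"

section \<open>Commutators\<close>

definition comm2 :: "'a::ring \<Rightarrow> 'a \<Rightarrow> 'a" where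
  "comm2 a b = a * b - b * a"

definition comm3 :: "'a::ring \<Rightarrow> 'a \<Rightarrow> 'a \<Rightarrow> 'a" where
  "comm3 a b c = comm2 (comm2 a b) c"

end

theory Submission
  imports Defs "HOL-Analysis.Cartesian_Space"
begin

text \<open>
  A polynomial is an identity of \<open>F\<^sub>k(A)\<close> iff it vanishes on every subalgebra of \<open>A\<close> generated
  by \<open>k\<close> elements (\<open>polynomial_identity_rel_free_iff\<close>). The two diagonal entries of an upper
  triangular matrix are algebra homomorphisms, so if \<open>u\<close> and \<open>v\<close> are identities of \<open>F\<^sub>k(A)\<close>,
  then on a subalgebra of \<open>UT\<^sub>2(A)\<close> with \<open>k\<close> generators both take strictly upper triangular
  values, whose product is zero. Thus \<open>u v\<close> is an identity of \<open>F\<^sub>k(UT\<^sub>2(A))\<close>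
  (\<open>product_of_identities_rel_free_UT2\<close>). Each of the four polynomials is such a product for
  \<open>A = G\<close>: the factors are triple commutators and products of \<open>m + 1\<close> commutators of length two.

  That these factors are identities of \<open>F\<^sub>k(G)\<close> follows from supercommutativity. Every element of
  \<open>G\<close> is a sum of an even element, which is central, and an odd one, and odd elements
  anticommute and have square zero. A commutator is therefore a commutator of odd elements, hence
  even and central, so triple commutators vanish (\<open>comm3_mem\<close>). Consider next \<open>k\<close> elements of \<open>G\<close>
  and the ideal \<open>H\<close> generated by their odd summands \<open>h\<^sub>1, \<dots>, h\<^sub>k\<close>. The sums of an even element and
  an element of \<open>H\<close> form a subalgebra that contains the \<open>k\<close> elements, and a commutator of two such
  sums lies in the square of \<open>H\<close>. The power of \<open>H\<close> with exponent \<open>k + 1\<close> is zero: in a product of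
  \<open>k + 1\<close> of the \<open>h\<^sub>i\<close> with arbitrary coefficients in between, the coefficients can be moved to the
  left, some \<open>h\<^sub>i\<close> occurs twice, and the two occurrences can be made adjacent. So a product of
  \<open>m + 1\<close> commutators, which lies in the power of \<open>H\<close> with exponent \<open>2m + 2 > k\<close>, is zero
  (\<open>comm2_product_mem\<close>).

  The computations in \<open>G\<close> are done with representatives in the free algebra, modulo the ideal
  generated by the squares of the linear polynomials.
\<close>

section \<open>Unital associative algebras and their homomorphisms\<close>

locale unital_algebra = ring A
  for A :: "('k::field, 'a, 'e) module_scheme" (structure) +
  assumes scale_closed [simp, intro]: "x \<in> carrier A \<Longrightarrow> c \<odot> x \<in> carrier A"
    and scale_add_left: "x \<in> carrier A \<Longrightarrow> (c + d) \<odot> x = c \<odot> x \<oplus> d \<odot> x"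
    and scale_add_right: "\<lbrakk>x \<in> carrier A; y \<in> carrier A\<rbrakk> \<Longrightarrow> c \<odot> (x \<oplus> y) = c \<odot> x \<oplus> c \<odot> y"
    and scale_scale: "x \<in> carrier A \<Longrightarrow> c \<odot> (d \<odot> x) = (c * d) \<odot> x"
    and scale_one [simp]: "x \<in> carrier A \<Longrightarrow> 1 \<odot> x = x"
    and scale_mult_left: "\<lbrakk>x \<in> carrier A; y \<in> carrier A\<rbrakk> \<Longrightarrow> (c \<odot> x) \<otimes> y = c \<odot> (x \<otimes> y)"
    and scale_mult_right: "\<lbrakk>x \<in> carrier A; y \<in> carrier A\<rbrakk> \<Longrightarrow> x \<otimes> (c \<odot> y) = c \<odot> (x \<otimes> y)"
begin

lemma scale_zero_left [simp]:
  assumes "x \<in> carrier A"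
  shows "0 \<odot> x = \<zero>"
proof -
  have "0 \<odot> x \<oplus> 0 \<odot> x = 0 \<odot> x \<oplus> \<zero>"
    using assms scale_add_left[of x 0 0] by simp
  then show ?thesis
    using assms by simp
qed

lemma scale_zero_right [simp]: "c \<odot> \<zero> = \<zero>"
  using scale_scale[of \<zero> c 0] scale_zero_left[of \<zero>] by (metis mult_zero_right zero_closed)

end

definition algebra_hom ::
    "('k, 'a, 'e) module_scheme \<Rightarrow> ('k, 'b, 'f) module_scheme \<Rightarrow> ('a \<Rightarrow> 'b) set" where
  "algebra_hom A B =
     {h \<in> ring_hom A B. \<forall>c. \<forall>x \<in> carrier A. h (c \<odot>\<^bsub>A\<^esub> x) = c \<odot>\<^bsub>B\<^esub> h x}"

lemma algebra_homD:
  assumes "h \<in> algebra_hom A B"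
  shows "x \<in> carrier A \<Longrightarrow> h x \<in> carrier B"
    and "\<lbrakk>x \<in> carrier A; y \<in> carrier A\<rbrakk> \<Longrightarrow> h (x \<otimes>\<^bsub>A\<^esub> y) = h x \<otimes>\<^bsub>B\<^esub> h y"
    and "\<lbrakk>x \<in> carrier A; y \<in> carrier A\<rbrakk> \<Longrightarrow> h (x \<oplus>\<^bsub>A\<^esub> y) = h x \<oplus>\<^bsub>B\<^esub> h y"
    and "h \<one>\<^bsub>A\<^esub> = \<one>\<^bsub>B\<^esub>"
    and "x \<in> carrier A \<Longrightarrow> h (c \<odot>\<^bsub>A\<^esub> x) = c \<odot>\<^bsub>B\<^esub> h x"
  using assms by (auto simp: algebra_hom_def ring_hom_def)

section \<open>Evaluation of noncommutative polynomials\<close>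

text \<open>Bilinear statements about polynomials reduce to monomials. The restriction to monomials that
  occur in the given polynomial lets hypotheses on its support, such as parity or the set of
  variables, be used in the monomial case.\<close>

lemma ncpoly_induct [case_names zero monomial add]:
  fixes f :: "'x word \<Rightarrow>\<^sub>0 'k::field"
  assumes "P 0"
    and "\<And>w c. w \<in> Poly_Mapping.keys f \<Longrightarrow> P (Poly_Mapping.single w c)"
    and "\<And>g h. \<lbrakk>P g; P h\<rbrakk> \<Longrightarrow> P (g + h)"
  shows "P f"
proof -
  have "P (\<Sum>w\<in>S. Poly_Mapping.single w (Poly_Mapping.lookup f w))"
    if "finite S" "S \<subseteq> Poly_Mapping.keys f" for S
    using that by (induction S rule: finite_induct) (auto intro: assms)
  moreover have "(\<Sum>w\<in>Poly_Mapping.keys f. Poly_Mapping.single w (Poly_Mapping.lookup f w)) = f"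
    by (rule poly_mapping_eqI) (auto simp: lookup_sum lookup_single when_def in_keys_iff)
  ultimately show ?thesis
    by (metis finite_keys order_refl)
qed

lemma free_algebra_simps [simp]:
  "mult (free_algebra V) = (*)" "one (free_algebra V) = 1"
  "zero (free_algebra V) = 0" "add (free_algebra V) = (+)"
  "smult (free_algebra V) c f = Poly_Mapping.single 0 c * f"
  by (simp_all add: free_algebra_def)

lemma in_free_algebra_iff:
  "f \<in> carrier (free_algebra V) \<longleftrightarrow> (\<forall>w \<in> Poly_Mapping.keys f. set (letters w) \<subseteq> V)"
  by (simp add: free_algebra_def)

lemma letters_plus [simp]: "letters (u + v) = letters u @ letters v"
  and letters_zero [simp]: "letters 0 = []"
  by (simp_all add: plus_word_def zero_word_def)

lemma carrier_free_algebra_UNIV [simp]: "carrier (free_algebra UNIV) = UNIV"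
  by (auto simp: in_free_algebra_iff)

lemma carrier_free_algebra_mono:
  "\<lbrakk>f \<in> carrier (free_algebra V); V \<subseteq> W\<rbrakk> \<Longrightarrow> f \<in> carrier (free_algebra W)"
  by (meson in_free_algebra_iff subset_trans)

lemma keys_uminus_ncpoly: "Poly_Mapping.keys (- (f :: ('x, 'k::field) ncpoly)) = Poly_Mapping.keys f"
  by (auto simp: in_keys_iff)

lemma monomial_in_free_algebra:
  "set (letters w) \<subseteq> V \<Longrightarrow> Poly_Mapping.single w c \<in> carrier (free_algebra V)"
  by (simp add: in_free_algebra_iff)

lemma free_algebra_mult_closed:
  assumes "f \<in> carrier (free_algebra V)" and "g \<in> carrier (free_algebra V)"
  shows "f * g \<in> carrier (free_algebra V)"
  unfolding in_free_algebra_iff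
proof
  fix w assume "w \<in> Poly_Mapping.keys (f * g)"
  then obtain u v where "u \<in> Poly_Mapping.keys f" "v \<in> Poly_Mapping.keys g" "w = u + v"
    using keys_mult[of f g] by blast
  then show "set (letters w) \<subseteq> V"
    using assms by (simp add: in_free_algebra_iff)
qed

lemma free_algebra_closed:
  fixes f g :: "('x, 'k::field) ncpoly"
  shows "0 \<in> carrier (free_algebra V)" "1 \<in> carrier (free_algebra V)"
    "\<lbrakk>f \<in> carrier (free_algebra V); g \<in> carrier (free_algebra V)\<rbrakk> \<Longrightarrow> f + g \<in> carrier (free_algebra V)"
    "\<lbrakk>f \<in> carrier (free_algebra V); g \<in> carrier (free_algebra V)\<rbrakk> \<Longrightarrow> f - g \<in> carrier (free_algebra V)"
    "\<lbrakk>f \<in> carrier (free_algebra V); g \<in> carrier (free_algebra V)\<rbrakk> \<Longrightarrow> f * g \<in> carrier (free_algebra V)"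
    "f \<in> carrier (free_algebra V) \<Longrightarrow> - f \<in> carrier (free_algebra V)"
    "f \<in> carrier (free_algebra V) \<Longrightarrow> Poly_Mapping.single 0 c * f \<in> carrier (free_algebra V)"
proof -
  show add: "p + q \<in> carrier (free_algebra V)"
    if "p \<in> carrier (free_algebra V)" "q \<in> carrier (free_algebra V)" for p q :: "('x, 'k) ncpoly"
    using that keys_add[of p q] unfolding in_free_algebra_iff by blast
  show uminus: "- p \<in> carrier (free_algebra V)" if "p \<in> carrier (free_algebra V)"
    for p :: "('x, 'k) ncpoly"
    using that by (simp add: in_free_algebra_iff keys_uminus_ncpoly)
  show "f - g \<in> carrier (free_algebra V)"
    if "f \<in> carrier (free_algebra V)" "g \<in> carrier (free_algebra V)"
    using add[OF that(1) uminus[OF that(2)]] by simp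
qed (simp_all add: free_algebra_mult_closed monomial_in_free_algebra,
     simp_all add: in_free_algebra_iff)

lemma var_closed: "i \<in> V \<Longrightarrow> var i \<in> carrier (free_algebra V)"
  by (simp add: var_def monomial_in_free_algebra)

lemma prod_list_closed:
  assumes "\<And>f. f \<in> set fs \<Longrightarrow> f \<in> carrier (free_algebra V)"
  shows "prod_list fs \<in> carrier (free_algebra V)"
  using assms by (induction fs) (simp_all add: free_algebra_closed)

lemma scalar_commutes:
  "f * Poly_Mapping.single 0 c = Poly_Mapping.single 0 c * (f :: ('x, 'k::field) ncpoly)"
  by (induction f rule: ncpoly_induct) (simp_all add: distrib_left distrib_right mult_single mult.commute)

lemma unital_algebra_free: "unital_algebra (free_algebra V :: ('k::field, ('x, 'k) ncpoly) module)"
proof -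
  let ?A = "free_algebra V :: ('k, ('x, 'k) ncpoly) module"
  have "abelian_group ?A"
  proof (rule abelian_groupI)
    fix x assume "x \<in> carrier ?A"
    then show "\<exists>y\<in>carrier ?A. y \<oplus>\<^bsub>?A\<^esub> x = \<zero>\<^bsub>?A\<^esub>"
      by (intro bexI[of _ "- x"]) (simp_all add: free_algebra_closed)
  qed (simp_all add: free_algebra_closed algebra_simps)
  moreover have "Group.monoid ?A"
    by (rule monoidI) (simp_all add: free_algebra_closed mult.assoc)
  ultimately have "ring ?A"
    by (rule ringI) (simp_all add: distrib_left distrib_right)
  moreover have "unital_algebra_axioms ?A"
  proof
    show "x \<otimes>\<^bsub>?A\<^esub> (c \<odot>\<^bsub>?A\<^esub> y) = c \<odot>\<^bsub>?A\<^esub> (x \<otimes>\<^bsub>?A\<^esub> y)" for x y c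
      by (simp add: scalar_commutes flip: mult.assoc)
  qed (simp_all add: free_algebra_closed distrib_left distrib_right single_add mult_single
        flip: mult.assoc)
  ultimately show ?thesis
    by (simp add: unital_algebra_def)
qed

context unital_algebra
begin

lemma eval_word_closed [simp, intro]:
  assumes "range a \<subseteq> carrier A"
  shows "eval_word A a w \<in> carrier A"
proof -
  have "foldr (\<lambda>i p. a i \<otimes> p) xs \<one> \<in> carrier A" for xs
    by (induction xs) (use assms in auto)
  then show ?thesis by (simp add: eval_word_def)
qed

lemma eval_word_plus:
  assumes "range a \<subseteq> carrier A"
  shows "eval_word A a (u + v) = eval_word A a u \<otimes> eval_word A a v"
proof -
  have "foldr (\<lambda>i p. a i \<otimes> p) (xs @ letters v) \<one> = foldr (\<lambda>i p. a i \<otimes> p) xs \<one> \<otimes> eval_word A a v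
      \<and> foldr (\<lambda>i p. a i \<otimes> p) xs \<one> \<in> carrier A" for xs
  proof (induction xs)
    case Nil
    then show ?case
      using eval_word_closed[OF assms, of v] by (simp add: eval_word_def)
  next
    case (Cons i xs)
    moreover have "a i \<in> carrier A" using assms by blast
    ultimately show ?case
      using eval_word_closed[OF assms, of v] by (simp add: m_assoc)
  qed
  then show ?thesis by (simp add: eval_word_def)
qed

lemma eval_poly_superset:
  assumes "range a \<subseteq> carrier A" and "finite S" and "Poly_Mapping.keys f \<subseteq> S"
  shows "eval_poly A a f = (\<Oplus>w\<in>S. Poly_Mapping.lookup f w \<odot> eval_word A a w)"
  unfolding eval_poly_def
  by (rule add.finprod_mono_neutral_cong_left) (use assms in \<open>auto simp: in_keys_iff\<close>)

lemma eval_poly_closed [simp, intro]: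
  "range a \<subseteq> carrier A \<Longrightarrow> eval_poly A a f \<in> carrier A"
  unfolding eval_poly_def by (rule finsum_closed) auto

lemma eval_poly_zero [simp]: "eval_poly A a 0 = \<zero>"
  by (simp add: eval_poly_def)

lemma eval_poly_add:
  assumes "range a \<subseteq> carrier A"
  shows "eval_poly A a (f + g) = eval_poly A a f \<oplus> eval_poly A a g"
proof -
  let ?S = "Poly_Mapping.keys f \<union> Poly_Mapping.keys g"
  have "eval_poly A a (f + g)
      = (\<Oplus>w\<in>?S. Poly_Mapping.lookup f w \<odot> eval_word A a w
              \<oplus> Poly_Mapping.lookup g w \<odot> eval_word A a w)"
    using assms keys_add[of f g]
    by (subst eval_poly_superset[where S = ?S])
      (auto simp: lookup_add scale_add_left intro!: add.finprod_cong')
  also have "\<dots> = eval_poly A a f \<oplus> eval_poly A a g"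
    using assms by (subst finsum_addf) (auto simp: eval_poly_superset[where S = ?S])
  finally show ?thesis .
qed

lemma eval_poly_monomial:
  assumes "range a \<subseteq> carrier A"
  shows "eval_poly A a (Poly_Mapping.single w c) = c \<odot> eval_word A a w"
  using assms by (subst eval_poly_superset[where S = "{w}"]) auto

lemma eval_poly_mult:
  assumes a: "range a \<subseteq> carrier A"
  shows "eval_poly A a (f * g) = eval_poly A a f \<otimes> eval_poly A a g"
proof (induction f rule: ncpoly_induct)
  case (monomial u c)
  show ?case
  proof (induction g rule: ncpoly_induct)
    case (monomial v d)
    show ?case
      using a by (simp add: mult_single eval_poly_monomial eval_word_plus
          scale_mult_left scale_mult_right scale_scale mult.commute)
  next
    case (add g h)
    then show ?case
      using a by (simp add: distrib_left eval_poly_add r_distr)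
  qed (use a in simp)
next
  case (add g h)
  then show ?case
    using a by (simp add: distrib_right eval_poly_add l_distr)
qed (use a in simp)

lemma eval_poly_one:
  assumes "range a \<subseteq> carrier A"
  shows "eval_poly A a 1 = \<one>"
  using eval_poly_monomial[OF assms, of 0 1] by (simp add: eval_word_def)

lemma eval_poly_var:
  assumes "range a \<subseteq> carrier A"
  shows "eval_poly A a (var i) = a i"
proof -
  have "a i \<in> carrier A" using assms by blast
  then show ?thesis
    using eval_poly_monomial[OF assms, of "Word [i]" 1] by (simp add: var_def eval_word_def)
qed

lemma eval_poly_hom:
  assumes "range a \<subseteq> carrier A"
  shows "eval_poly A a \<in> algebra_hom (free_algebra V) A"
  using assms
  by (auto simp: algebra_hom_def eval_poly_mult eval_poly_add eval_poly_one eval_poly_monomial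
      eval_word_def scale_mult_left intro!: ring_hom_memI)

end

text \<open>This is how identities pass between algebras: through quotient maps, through diagonal entries of
  matrices, and, taking the homomorphism to be an evaluation itself, through the composition of
  two evaluations.\<close>

lemma hom_eval_poly:
  assumes "unital_algebra A" and "unital_algebra B" and h: "h \<in> algebra_hom A B"
    and a: "range a \<subseteq> carrier A"
  shows "h (eval_poly A a f) = eval_poly B (h \<circ> a) f"
proof -
  interpret A: unital_algebra A by fact
  interpret B: unital_algebra B by fact
  note hD = algebra_homD[OF h]
  have b: "range (h \<circ> a) \<subseteq> carrier B"
    using a hD(1) by auto
  have "h (foldr (\<lambda>i p. a i \<otimes>\<^bsub>A\<^esub> p) xs \<one>\<^bsub>A\<^esub>) = foldr (\<lambda>i p. (h \<circ> a) i \<otimes>\<^bsub>B\<^esub> p) xs \<one>\<^bsub>B\<^esub>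
      \<and> foldr (\<lambda>i p. a i \<otimes>\<^bsub>A\<^esub> p) xs \<one>\<^bsub>A\<^esub> \<in> carrier A" for xs
    by (induction xs) (use a in \<open>auto simp: hD range_subsetD\<close>)
  then have word: "h (eval_word A a w) = eval_word B (h \<circ> a) w" for w
    by (simp add: eval_word_def)
  have "h \<zero>\<^bsub>A\<^esub> = \<zero>\<^bsub>B\<^esub>"
    using hD(5)[of "\<zero>\<^bsub>A\<^esub>" 0] hD(1)[of "\<zero>\<^bsub>A\<^esub>"] by simp
  then show ?thesis
    using a b
    by (induction f rule: ncpoly_induct)
      (simp_all add: A.eval_poly_monomial B.eval_poly_monomial word hD
        A.eval_poly_add B.eval_poly_add)
qed

text \<open>Used to give an assignment defined only on the variables that matter harmless values elsewhere,
  so that evaluation becomes a homomorphism on the whole free algebra.\<close>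

lemma (in unital_algebra) eval_poly_cong:
  assumes f: "f \<in> carrier (free_algebra V)" and b: "range b \<subseteq> carrier A"
    and eq: "\<And>i. i \<in> V \<Longrightarrow> a i = b i"
  shows "eval_poly A a f = eval_poly A b f"
proof -
  have "eval_word A a w = eval_word A b w" if "w \<in> Poly_Mapping.keys f" for w
  proof -
    have "a i = b i" if "i \<in> set (letters w)" for i
      using that \<open>w \<in> Poly_Mapping.keys f\<close> f eq by (auto simp: in_free_algebra_iff)
    then show ?thesis
      unfolding eval_word_def by (intro foldr_cong) simp_all
  qed
  then show ?thesis
    unfolding eval_poly_def using b by (intro finsum_cong') auto
qed

section \<open>Quotient algebras\<close>

context
  fixes A :: "('k::field, 'a, 'e) module_scheme" (structure) and I
  assumes A: "unital_algebra A" and I: "ideal I A"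
begin

interpretation unital_algebra A by (rule A)
interpretation ideal I A by (rule I)
interpretation Q: ring "A Quot I" by (rule quotient_is_ring)

lemma quot_algebra_simps:
  "carrier (quot_algebra A I) = carrier (A Quot I)" "mult (quot_algebra A I) = mult (A Quot I)"
  "one (quot_algebra A I) = one (A Quot I)" "zero (quot_algebra A I) = zero (A Quot I)"
  "add (quot_algebra A I) = add (A Quot I)"
  by (simp_all add: quot_algebra_def)

lemma carrier_quot_algebra: "carrier (quot_algebra A I) = (+>) I ` carrier A"
  by (auto simp: quot_algebra_simps FactRing_simps)

lemma zero_quot_algebra: "\<zero>\<^bsub>quot_algebra A I\<^esub> = I"
  by (simp add: quot_algebra_simps FactRing_def)

lemma scale_in_ideal:
  assumes "x \<in> I"
  shows "c \<odot> x \<in> I"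
proof -
  have x: "x \<in> carrier A" using assms by (rule a_Hcarr)
  then have "c \<odot> x = (c \<odot> \<one>) \<otimes> x"
    by (simp add: scale_mult_left)
  then show ?thesis
    using I_l_closed[OF assms] by simp
qed

text \<open>The union in the definition of scalar multiplication has a single distinct member, because an
  ideal of a unital algebra absorbs scalars.\<close>

lemma scale_coset:
  assumes y: "y \<in> carrier A"
  shows "c \<odot>\<^bsub>quot_algebra A I\<^esub> (I +> y) = I +> (c \<odot> y)"
proof -
  have "I +> (c \<odot> x) = I +> (c \<odot> y)" if "x \<in> I +> y" for x
  proof -
    from that obtain i where i: "i \<in> I" "x = i \<oplus> y"
      by (auto simp: a_r_coset_def')
    then have "c \<odot> x = c \<odot> i \<oplus> c \<odot> y"
      using y a_Hcarr by (simp add: scale_add_right)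
    then have "c \<odot> x \<in> I +> (c \<odot> y)"
      using scale_in_ideal[OF i(1)] by (auto simp: a_r_coset_def')
    then show ?thesis
      using y by (metis a_repr_independence' scale_closed)
  qed
  moreover have "I +> y \<noteq> {}" using a_rcos_self[OF y] by blast
  ultimately have "(\<Union>x\<in>I +> y. I +> (c \<odot> x)) = I +> (c \<odot> y)"
    by (intro SUP_eq_const) blast+
  then show ?thesis
    by (simp add: quot_algebra_def)
qed

lemma coset_hom: "(+>) I \<in> algebra_hom A (quot_algebra A I)"
  using rcos_ring_hom by (simp add: algebra_hom_def ring_hom_def quot_algebra_simps scale_coset)

lemma unital_algebra_quot: "unital_algebra (quot_algebra A I)"
proof -
  let ?Q = "quot_algebra A I"
  have "abelian_group ?Q"
  proof (rule abelian_groupI)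
    show "\<exists>y\<in>carrier ?Q. y \<oplus>\<^bsub>?Q\<^esub> x = \<zero>\<^bsub>?Q\<^esub>" if "x \<in> carrier ?Q" for x
      using that Q.a_inv_closed Q.l_neg unfolding quot_algebra_simps by blast
  qed (simp_all add: quot_algebra_simps Q.a_ac)
  moreover have "Group.monoid ?Q"
    by (rule monoidI) (simp_all add: quot_algebra_simps Q.m_assoc)
  ultimately have "ring ?Q"
    by (rule ringI) (simp_all add: quot_algebra_simps Q.l_distr Q.r_distr)
  moreover have "unital_algebra_axioms ?Q"
  proof -
    have sum: "(I +> x) \<oplus>\<^bsub>?Q\<^esub> (I +> y) = I +> (x \<oplus> y)"
      and mult: "(I +> x) \<otimes>\<^bsub>?Q\<^esub> (I +> y) = I +> (x \<otimes> y)"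
      if "x \<in> carrier A" "y \<in> carrier A" for x y
      using that algebra_homD(2,3)[OF coset_hom] by simp_all
    show ?thesis
      by (unfold_locales; unfold carrier_quot_algebra; elim imageE; hypsubst)
        (simp_all add: scale_coset sum mult scale_add_left scale_add_right scale_scale
          scale_mult_left scale_mult_right)
  qed
  ultimately show ?thesis
    by (simp add: unital_algebra_def)
qed

lemma eval_poly_quot:
  assumes "range a \<subseteq> carrier A"
  shows "eval_poly (quot_algebra A I) ((+>) I \<circ> a) f = I +> eval_poly A a f"
  using hom_eval_poly[OF A unital_algebra_quot coset_hom assms] by simp

lemma coset_eq_zero_iff:
  assumes "x \<in> carrier A"
  shows "I +> x = \<zero>\<^bsub>quot_algebra A I\<^esub> \<longleftrightarrow> x \<in> I"
  using assms a_rcos_const a_rcos_self by (metis zero_quot_algebra)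

text \<open>Together with the evaluation of cosets, this turns every assertion about values in a quotient into
  a membership in the ideal.\<close>

lemma lift_to_representatives:
  assumes "range b \<subseteq> carrier (quot_algebra A I)"
  obtains a where "range a \<subseteq> carrier A" and "b = (+>) I \<circ> a"
proof -
  have "\<exists>a. \<forall>i. a i \<in> carrier A \<and> b i = I +> a i"
    by (intro choice) (use assms in \<open>auto simp: carrier_quot_algebra\<close>)
  then show ?thesis
    using that by (metis comp_apply ext image_subsetI)
qed

end

section \<open>Identities of relatively free algebras\<close>

lemma polynomial_identity_iff:
  fixes A :: "('k::field, 'a, 'e) module_scheme" (structure)
  assumes "unital_algebra A"
  shows "polynomial_identity A f \<longleftrightarrow> f \<in> carrier (free_algebra {1..})
    \<and> (\<forall>a. range a \<subseteq> carrier A \<longrightarrow> eval_poly A a f = \<zero>\<^bsub>A\<^esub>)"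
proof -
  interpret unital_algebra A by fact
  have "eval_poly A a f = \<zero>"
    if f: "f \<in> carrier (free_algebra {1..})" and a: "a \<in> {1..} \<rightarrow> carrier A"
      and zero: "\<forall>a. range a \<subseteq> carrier A \<longrightarrow> eval_poly A a f = \<zero>" for a
  proof -
    \<comment> \<open>The assignment says nothing about the value at the unused index 0.\<close>
    let ?b = "a(0 := \<zero>)"
    have b: "range ?b \<subseteq> carrier A"
      using a by (auto simp: Pi_def Suc_le_eq)
    have "eval_poly A a f = eval_poly A ?b f"
      by (rule eval_poly_cong[OF f b]) auto
    then show ?thesis using zero b by simp
  qed
  then show ?thesis
    unfolding polynomial_identity_def by blast
qed

text \<open>The intersection of the kernels of all evaluations, which are homomorphisms on the free algebra.
  The inclusion of \<open>V\<close> keeps products inside the polynomials in \<open>x\<^sub>1, x\<^sub>2, \<dots>\<close>.\<close>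

lemma ideal_T_ideal:
  fixes A :: "('k::field, 'a, 'e) module_scheme" (structure)
  assumes "unital_algebra A" and "V \<subseteq> {1..}"
  shows "ideal (T_ideal A \<inter> carrier (free_algebra V)) (free_algebra V)"
proof -
  interpret unital_algebra A by fact
  interpret F: unital_algebra "free_algebra V :: ('k, (nat, 'k) ncpoly) module" by (rule unital_algebra_free)
  define J where "J = T_ideal A \<inter> carrier (free_algebra V)"
  have J_iff: "f \<in> J \<longleftrightarrow> f \<in> carrier (free_algebra V)
      \<and> (\<forall>a. range a \<subseteq> carrier A \<longrightarrow> eval_poly A a f = \<zero>)" for f
    using carrier_free_algebra_mono[OF _ assms(2)]
    by (auto simp: J_def T_ideal_def polynomial_identity_iff[OF assms(1)])
  have uminus: "\<ominus>\<^bsub>free_algebra V\<^esub> f = Poly_Mapping.single 0 (- 1) * f"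
    if "f \<in> carrier (free_algebra V)" for f :: "(nat, 'k) ncpoly"
  proof -
    have "f + Poly_Mapping.single 0 (- 1) * f = 0"
      using F.scale_add_left[OF that, of 1 "- 1"] by simp
    then show ?thesis
      using that by (intro F.minus_equality) (simp_all add: free_algebra_closed add.commute)
  qed
  have "subgroup J (add_monoid (free_algebra V))"
  proof (rule F.add.subgroupI)
    show "J \<noteq> {}"
      using J_iff[of 0] by (auto simp: free_algebra_closed)
  qed (auto simp: J_iff free_algebra_closed eval_poly_add eval_poly_mult uminus eval_poly_monomial
       a_inv_def[symmetric])
  then have "ideal J (free_algebra V)"
    by (rule idealI[OF F.ring_axioms]) (auto simp: J_iff free_algebra_closed eval_poly_mult)
  then show ?thesis
    by (simp add: J_def)
qed

text \<open>Elements of the relatively free algebra of rank \<open>k\<close> are represented by polynomials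
  \<open>g\<^sub>i\<close> in \<open>k\<close> variables, so \<open>f\<close> is an identity of it iff \<open>f(g\<^sub>1, g\<^sub>2, \<dots>)\<close> is an
  identity of \<open>A\<close>. Since substitution commutes with evaluation, this says that \<open>f\<close> vanishes
  on every subalgebra of \<open>A\<close> generated by \<open>k\<close> elements.\<close>

lemma polynomial_identity_rel_free_iff:
  fixes A :: "('k::field, 'a, 'e) module_scheme" (structure)
  assumes A: "unital_algebra A"
  shows "polynomial_identity (rel_free_algebra k A) f \<longleftrightarrow> f \<in> carrier (free_algebra {1..})
    \<and> (\<forall>a g. range a \<subseteq> carrier A \<longrightarrow> range g \<subseteq> carrier (free_algebra {1..k})
         \<longrightarrow> eval_poly A (\<lambda>i. eval_poly A a (g i)) f = \<zero>\<^bsub>A\<^esub>)"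
    (is "_ \<longleftrightarrow> _ \<and> ?vanishes")
proof -
  interpret unital_algebra A by fact
  let ?R = "free_algebra {1..k} :: ('k, (nat, 'k) ncpoly) module"
  let ?J = "T_ideal A \<inter> carrier ?R"
  let ?F = "quot_algebra ?R ?J"
  have R: "unital_algebra ?R" by (rule unital_algebra_free)
  interpret R: unital_algebra ?R by (rule R)
  have J: "ideal ?J ?R" by (rule ideal_T_ideal[OF A]) auto
  note quot = unital_algebra_quot[OF R J] eval_poly_quot[OF R J] coset_eq_zero_iff[OF R J]
  have "(\<forall>b. range b \<subseteq> carrier ?F \<longrightarrow> eval_poly ?F b f = \<zero>\<^bsub>?F\<^esub>)
    \<longleftrightarrow> (\<forall>g. range g \<subseteq> carrier ?R \<longrightarrow> eval_poly ?R g f \<in> ?J)"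
  proof (intro iffI allI impI)
    fix g :: "nat \<Rightarrow> (nat, 'k) ncpoly"
    assume *: "\<forall>b. range b \<subseteq> carrier ?F \<longrightarrow> eval_poly ?F b f = \<zero>\<^bsub>?F\<^esub>"
      and g: "range g \<subseteq> carrier ?R"
    have "range ((+>\<^bsub>?R\<^esub>) ?J \<circ> g) \<subseteq> carrier ?F"
      unfolding carrier_quot_algebra[OF R J] using g by auto
    then have "eval_poly ?F ((+>\<^bsub>?R\<^esub>) ?J \<circ> g) f = \<zero>\<^bsub>?F\<^esub>"
      using * by blast
    then show "eval_poly ?R g f \<in> ?J"
      unfolding quot(2)[OF g] using quot(3)[OF R.eval_poly_closed[OF g]] by blast
  next
    fix b :: "nat \<Rightarrow> (nat, 'k) ncpoly set"
    assume *: "\<forall>g. range g \<subseteq> carrier ?R \<longrightarrow> eval_poly ?R g f \<in> ?J"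
      and b: "range b \<subseteq> carrier ?F"
    obtain g where g: "range g \<subseteq> carrier ?R" and b_eq: "b = (+>\<^bsub>?R\<^esub>) ?J \<circ> g"
      using lift_to_representatives[OF R J b] by blast
    show "eval_poly ?F b f = \<zero>\<^bsub>?F\<^esub>"
      unfolding b_eq quot(2)[OF g] using quot(3)[OF R.eval_poly_closed[OF g]] * g by blast
  qed
  also have "\<dots> \<longleftrightarrow> ?vanishes"
  proof -
    have key: "eval_poly ?R g f \<in> ?J \<longleftrightarrow>
        (\<forall>a. range a \<subseteq> carrier A \<longrightarrow> eval_poly A (\<lambda>i. eval_poly A a (g i)) f = \<zero>)"
      if g: "range g \<subseteq> carrier ?R" for g
    proof -
      have "eval_poly A a (eval_poly ?R g f) = eval_poly A (\<lambda>i. eval_poly A a (g i)) f"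
        if "range a \<subseteq> carrier A" for a
        using hom_eval_poly[OF R A eval_poly_hom[OF that] g] by (simp add: comp_def)
      moreover have "eval_poly ?R g f \<in> carrier (free_algebra {1..})"
        using R.eval_poly_closed[OF g] by (rule carrier_free_algebra_mono) auto
      ultimately show ?thesis
        using R.eval_poly_closed[OF g] by (auto simp: T_ideal_def polynomial_identity_iff[OF A])
    qed
    show ?thesis
    proof (intro iffI allI impI)
      fix a :: "nat \<Rightarrow> 'a" and g :: "nat \<Rightarrow> (nat, 'k) ncpoly"
      assume "\<forall>g. range g \<subseteq> carrier ?R \<longrightarrow> eval_poly ?R g f \<in> ?J"
        and a: "range a \<subseteq> carrier A" and g: "range g \<subseteq> carrier ?R"
      then have "eval_poly ?R g f \<in> ?J" by blast
      with a show "eval_poly A (\<lambda>i. eval_poly A a (g i)) f = \<zero>"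
        unfolding key[OF g] by blast
    next
      fix g :: "nat \<Rightarrow> (nat, 'k) ncpoly"
      assume ?vanishes and g: "range g \<subseteq> carrier ?R"
      then show "eval_poly ?R g f \<in> ?J"
        unfolding key[OF g] by blast
    qed
  qed
  finally show ?thesis
    unfolding rel_free_algebra_def polynomial_identity_iff[OF quot(1)] by (rule conj_cong[OF refl])
qed

section \<open>Upper triangular matrices\<close>

context
  fixes A :: "('k::field, 'a, 'e) module_scheme" (structure)
  assumes A: "unital_algebra A"
begin

interpretation unital_algebra A by (rule A)

lemma UT2_entry_closed: "M \<in> carrier (UT2 A) \<Longrightarrow> M $ i $ j \<in> carrier A"
  and UT2_lower_entry: "M \<in> carrier (UT2 A) \<Longrightarrow> M $ 2 $ 1 = \<zero>"
  by (simp_all add: UT2_def)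

lemma UT2_mult_entries:
  assumes "M \<in> carrier (UT2 A)" and "N \<in> carrier (UT2 A)"
  shows "(M \<otimes>\<^bsub>UT2 A\<^esub> N) $ 1 $ 1 = M $ 1 $ 1 \<otimes> N $ 1 $ 1"
    and "(M \<otimes>\<^bsub>UT2 A\<^esub> N) $ 1 $ 2 = M $ 1 $ 1 \<otimes> N $ 1 $ 2 \<oplus> M $ 1 $ 2 \<otimes> N $ 2 $ 2"
    and "(M \<otimes>\<^bsub>UT2 A\<^esub> N) $ 2 $ 1 = \<zero>"
    and "(M \<otimes>\<^bsub>UT2 A\<^esub> N) $ 2 $ 2 = M $ 2 $ 2 \<otimes> N $ 2 $ 2"
  using assms
  by (simp_all add: UT2_def UNIV_2 finsum_insert Pi_def)

lemma UT2_entries: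
  "(M \<oplus>\<^bsub>UT2 A\<^esub> N) $ i $ j = M $ i $ j \<oplus> N $ i $ j"
  "(c \<odot>\<^bsub>UT2 A\<^esub> M) $ i $ j = c \<odot> M $ i $ j"
  "\<zero>\<^bsub>UT2 A\<^esub> $ i $ j = \<zero>"
  "\<one>\<^bsub>UT2 A\<^esub> $ i $ j = (if i = j then \<one> else \<zero>)"
  by (simp_all add: UT2_def)

lemma in_UT2_iff:
  "M \<in> carrier (UT2 A) \<longleftrightarrow> M $ 1 $ 1 \<in> carrier A \<and> M $ 1 $ 2 \<in> carrier A
    \<and> M $ 2 $ 1 = \<zero> \<and> M $ 2 $ 2 \<in> carrier A"
  by (auto simp: UT2_def forall_2)

lemma UT2_eqI:
  assumes "M $ 1 $ 1 = N $ 1 $ 1" "M $ 1 $ 2 = N $ 1 $ 2" "M $ 2 $ 1 = N $ 2 $ 1"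
    "M $ 2 $ 2 = N $ 2 $ 2"
  shows "M = (N :: 'a ^ 2 ^ 2)"
  using assms by (simp add: vec_eq_iff forall_2)

lemma UT2_closed:
  assumes "M \<in> carrier (UT2 A)" and "N \<in> carrier (UT2 A)"
  shows "M \<otimes>\<^bsub>UT2 A\<^esub> N \<in> carrier (UT2 A)" and "M \<oplus>\<^bsub>UT2 A\<^esub> N \<in> carrier (UT2 A)"
    and "c \<odot>\<^bsub>UT2 A\<^esub> M \<in> carrier (UT2 A)"
  unfolding in_UT2_iff UT2_mult_entries[OF assms] UT2_entries
  using assms by (simp_all add: in_UT2_iff)

lemma UT2_zero_one_closed: "\<zero>\<^bsub>UT2 A\<^esub> \<in> carrier (UT2 A)" "\<one>\<^bsub>UT2 A\<^esub> \<in> carrier (UT2 A)"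
  by (simp_all add: in_UT2_iff UT2_entries)

lemma unital_algebra_UT2: "unital_algebra (UT2 A)"
proof -
  let ?U = "UT2 A"
  note simps = UT2_entries UT2_mult_entries UT2_closed UT2_zero_one_closed
    UT2_entry_closed UT2_lower_entry
  have "abelian_group ?U"
  proof (rule abelian_groupI)
    fix M assume M: "M \<in> carrier ?U"
    let ?N = "(\<chi> i j. \<ominus> (M $ i $ j)) :: 'a ^ 2 ^ 2"
    have "?N \<in> carrier ?U"
      using M by (simp add: in_UT2_iff)
    moreover have "?N \<oplus>\<^bsub>?U\<^esub> M = \<zero>\<^bsub>?U\<^esub>"
      by (rule UT2_eqI) (simp_all add: simps l_neg M)
    ultimately show "\<exists>N\<in>carrier ?U. N \<oplus>\<^bsub>?U\<^esub> M = \<zero>\<^bsub>?U\<^esub>" by blast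
  next
    fix M N P assume "M \<in> carrier ?U" "N \<in> carrier ?U" "P \<in> carrier ?U"
    then show "M \<oplus>\<^bsub>?U\<^esub> N \<oplus>\<^bsub>?U\<^esub> P = M \<oplus>\<^bsub>?U\<^esub> (N \<oplus>\<^bsub>?U\<^esub> P)"
      by (intro UT2_eqI) (simp_all add: simps a_assoc)
  next
    fix M N assume "M \<in> carrier ?U" "N \<in> carrier ?U"
    then show "M \<oplus>\<^bsub>?U\<^esub> N = N \<oplus>\<^bsub>?U\<^esub> M"
      by (intro UT2_eqI) (simp_all add: simps a_comm)
  next
    fix M assume "M \<in> carrier ?U"
    then show "\<zero>\<^bsub>?U\<^esub> \<oplus>\<^bsub>?U\<^esub> M = M"
      by (intro UT2_eqI) (simp_all add: simps)
  qed (simp_all add: simps)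
  moreover have "Group.monoid ?U"
  proof (rule monoidI)
    fix M N P assume "M \<in> carrier ?U" "N \<in> carrier ?U" "P \<in> carrier ?U"
    then show "M \<otimes>\<^bsub>?U\<^esub> N \<otimes>\<^bsub>?U\<^esub> P = M \<otimes>\<^bsub>?U\<^esub> (N \<otimes>\<^bsub>?U\<^esub> P)"
      by (intro UT2_eqI) (simp_all add: simps m_assoc l_distr r_distr a_assoc)
  next
    fix M assume "M \<in> carrier ?U"
    then show "\<one>\<^bsub>?U\<^esub> \<otimes>\<^bsub>?U\<^esub> M = M" "M \<otimes>\<^bsub>?U\<^esub> \<one>\<^bsub>?U\<^esub> = M"
      by (intro UT2_eqI; simp add: simps)+
  qed (simp_all add: simps)
  ultimately have "ring ?U"
  proof (rule ringI)
    fix M N P assume "M \<in> carrier ?U" "N \<in> carrier ?U" "P \<in> carrier ?U"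
    then show "(M \<oplus>\<^bsub>?U\<^esub> N) \<otimes>\<^bsub>?U\<^esub> P = M \<otimes>\<^bsub>?U\<^esub> P \<oplus>\<^bsub>?U\<^esub> N \<otimes>\<^bsub>?U\<^esub> P"
      and "P \<otimes>\<^bsub>?U\<^esub> (M \<oplus>\<^bsub>?U\<^esub> N) = P \<otimes>\<^bsub>?U\<^esub> M \<oplus>\<^bsub>?U\<^esub> P \<otimes>\<^bsub>?U\<^esub> N"
      by (intro UT2_eqI; simp add: simps l_distr r_distr a_ac)+
  qed
  moreover have "unital_algebra_axioms ?U"
    by unfold_locales
      (intro UT2_eqI; simp add: simps scale_add_left scale_add_right scale_scale
        scale_mult_left scale_mult_right; fail | simp add: simps)+
  ultimately show ?thesis
    by (simp add: unital_algebra_def)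
qed

lemma diagonal_entry_hom: "(\<lambda>M. M $ i $ i) \<in> algebra_hom (UT2 A) A"
  using exhaust_2[of i]
  by (auto simp: algebra_hom_def UT2_entries UT2_mult_entries UT2_entry_closed
      intro!: ring_hom_memI)

text \<open>A matrix whose first column is zero, times a matrix whose second row is zero.\<close>

lemma UT2_mult_eq_zero:
  assumes "M \<in> carrier (UT2 A)" and "N \<in> carrier (UT2 A)"
    and "M $ 1 $ 1 = \<zero>" and "N $ 2 $ 2 = \<zero>"
  shows "M \<otimes>\<^bsub>UT2 A\<^esub> N = \<zero>\<^bsub>UT2 A\<^esub>"
  using assms
  by (intro UT2_eqI) (simp_all add: UT2_mult_entries UT2_entries UT2_entry_closed)

text \<open>Diagonal entries of upper triangular matrices are homomorphisms to \<open>A\<close>, and they map a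
  subalgebra with \<open>k\<close> generators to one with \<open>k\<close> generators. Hence the value of \<open>u\<close> has zero
  upper left entry and that of \<open>v\<close> has zero lower right entry, and such matrices multiply to zero.\<close>

theorem product_of_identities_rel_free_UT2:
  assumes u: "polynomial_identity (rel_free_algebra k A) u"
    and v: "polynomial_identity (rel_free_algebra k A) v"
  shows "polynomial_identity (rel_free_algebra k (UT2 A)) (u * v)"
proof -
  let ?U = "UT2 A"
  note iff = polynomial_identity_rel_free_iff
  interpret U: unital_algebra ?U by (rule unital_algebra_UT2)
  have "eval_poly ?U (\<lambda>i. eval_poly ?U a (g i)) (u * v) = \<zero>\<^bsub>?U\<^esub>"
    if a: "range a \<subseteq> carrier ?U" and g: "range g \<subseteq> carrier (free_algebra {1..k})" for a g
  proof -
    let ?N = "\<lambda>i. eval_poly ?U a (g i)"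
    have N: "range ?N \<subseteq> carrier ?U" using a by auto
    have diagonal: "eval_poly ?U ?N f $ l $ l = \<zero>"
      if f: "polynomial_identity (rel_free_algebra k A) f" for f l
    proof -
      note entry = hom_eval_poly[OF unital_algebra_UT2 A diagonal_entry_hom]
      have "range (\<lambda>i. a i $ l $ l) \<subseteq> carrier A"
        using a by (auto intro!: UT2_entry_closed)
      then have "eval_poly A (\<lambda>i. eval_poly A (\<lambda>j. a j $ l $ l) (g i)) f = \<zero>"
        using f g unfolding iff[OF A] by blast
      then show ?thesis
        unfolding entry[OF N] comp_def entry[OF a] .
    qed
    show ?thesis
      unfolding U.eval_poly_mult[OF N]
      by (rule UT2_mult_eq_zero) (simp_all add: diagonal u v N)
  qed
  moreover have "u * v \<in> carrier (free_algebra {1..})"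
    using u v by (intro free_algebra_mult_closed) (simp_all add: iff[OF A])
  ultimately show ?thesis
    unfolding iff[OF unital_algebra_UT2] by blast
qed

end

section \<open>Commutators in a ring that is supercommutative modulo an ideal\<close>

text \<open>The quotient by \<open>I\<close> is a sum of a part \<open>Ev\<close> that is central in it and a part \<open>Od\<close> whose
  elements anticommute and square to zero there. Working with memberships in \<open>I\<close> rather than
  with cosets keeps the computations in the ring itself.\<close>

locale supercommutative_mod =
  fixes I Ev Od :: "'a::ring_1 set"
  assumes zero_mem: "0 \<in> I"
    and add_mem: "\<lbrakk>x \<in> I; y \<in> I\<rbrakk> \<Longrightarrow> x + y \<in> I"
    and mult_left_mem: "x \<in> I \<Longrightarrow> r * x \<in> I"
    and mult_right_mem: "x \<in> I \<Longrightarrow> x * r \<in> I"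
    and parity_split: "\<exists>e\<in>Ev. \<exists>d\<in>Od. r = e + d"
    and even_add: "\<lbrakk>e \<in> Ev; e' \<in> Ev\<rbrakk> \<Longrightarrow> e + e' \<in> Ev"
    and even_mult: "\<lbrakk>e \<in> Ev; e' \<in> Ev\<rbrakk> \<Longrightarrow> e * e' \<in> Ev"
    and odd_comm2_even: "\<lbrakk>d \<in> Od; d' \<in> Od\<rbrakk> \<Longrightarrow> comm2 d d' \<in> Ev"
    and even_central: "e \<in> Ev \<Longrightarrow> comm2 e r \<in> I"
    and odd_anticommute: "\<lbrakk>d \<in> Od; d' \<in> Od\<rbrakk> \<Longrightarrow> d * d' + d' * d \<in> I"
    and odd_square: "d \<in> Od \<Longrightarrow> d * d \<in> I"
begin

lemma uminus_mem: "x \<in> I \<Longrightarrow> - x \<in> I"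
  using mult_left_mem[of x "- 1"] by simp

lemma diff_mem: "\<lbrakk>x \<in> I; y \<in> I\<rbrakk> \<Longrightarrow> x - y \<in> I"
  using add_mem[of x "- y"] uminus_mem by simp

lemma even_central': "e \<in> Ev \<Longrightarrow> comm2 r e \<in> I"
  using uminus_mem[OF even_central[of e r]] by (simp add: comm2_def)

text \<open>Modulo \<open>I\<close> a commutator depends only on odd summands of its arguments, and a commutator of odd
  elements is even, hence central.\<close>

theorem comm3_mem: "comm3 p q r \<in> I"
proof -
  obtain e d where p: "e \<in> Ev" "d \<in> Od" "p = e + d" using parity_split by blast
  obtain e' d' where q: "e' \<in> Ev" "d' \<in> Od" "q = e' + d'" using parity_split by blast
  have "comm2 p q - comm2 d d' = comm2 e q + comm2 d e'"
    by (simp add: p(3) q(3) comm2_def algebra_simps)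
  also have "\<dots> \<in> I"
    using p q by (intro add_mem even_central even_central')
  finally have "comm2 (comm2 p q - comm2 d d') r \<in> I"
    by (simp add: comm2_def diff_mem mult_left_mem mult_right_mem)
  moreover have "comm2 (comm2 d d') r \<in> I"
    using p q by (intro even_central odd_comm2_even)
  ultimately have "comm2 (comm2 p q - comm2 d d') r + comm2 (comm2 d d') r \<in> I"
    by (rule add_mem)
  then show ?thesis
    by (simp add: comm3_def comm2_def algebra_simps)
qed

text \<open>Moving an odd element past \<open>r\<close> changes the sign of the odd summand of \<open>r\<close>. All that the
  following arguments need is that some \<open>r'\<close> results.\<close>

lemma odd_move:
  assumes "d \<in> Od"
  obtains r' where "d * r - r' * d \<in> I"
proof -
  obtain e d' where r: "e \<in> Ev" "d' \<in> Od" "r = e + d'" using parity_split by blast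
  have "d * r - (e - d') * d = comm2 d e + (d * d' + d' * d)"
    by (simp add: r(3) comm2_def algebra_simps)
  also have "\<dots> \<in> I"
    using assms r by (intro add_mem even_central' odd_anticommute)
  finally show thesis by (rule that)
qed

lemma odd_product_move:
  assumes "set ds \<subseteq> Od"
  shows "\<exists>r'. prod_list ds * r - r' * prod_list ds \<in> I"
  using assms
proof (induction ds)
  case Nil
  show ?case by (rule exI[of _ r]) (simp add: zero_mem)
next
  case (Cons d ds)
  then obtain r1 where r1: "prod_list ds * r - r1 * prod_list ds \<in> I" by auto
  obtain r2 where r2: "d * r1 - r2 * d \<in> I"
    using Cons.prems odd_move[of d r1] by auto
  have "prod_list (d # ds) * r - r2 * prod_list (d # ds)
      = d * (prod_list ds * r - r1 * prod_list ds) + (d * r1 - r2 * d) * prod_list ds"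
    by (simp add: algebra_simps)
  also have "\<dots> \<in> I"
    using r1 r2 by (intro add_mem mult_left_mem mult_right_mem)
  finally show ?case by blast
qed

text \<open>The two equal factors can be moved next to each other.\<close>

lemma odd_product_repeated:
  assumes "set ds \<subseteq> Od" and "\<not> distinct ds"
  shows "prod_list ds \<in> I"
proof -
  obtain as bs cs d where ds: "ds = as @ [d] @ bs @ [d] @ cs"
    using not_distinct_decomp[OF assms(2)] by blast
  then have d: "d \<in> Od" using assms(1) by auto
  obtain r where r: "d * prod_list bs - r * d \<in> I" by (rule odd_move[OF d])
  have "(d * prod_list bs - r * d) * d + r * (d * d) \<in> I"
    by (intro add_mem mult_left_mem mult_right_mem r odd_square d)
  then have "d * prod_list bs * d \<in> I"
    by (simp add: algebra_simps)
  then have "prod_list as * (d * prod_list bs * d) * prod_list cs \<in> I"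
    by (rule mult_right_mem[OF mult_left_mem])
  then show ?thesis
    by (simp add: ds mult.assoc)
qed

text \<open>For \<open>X\<close> contained in \<open>Od\<close>, this is \<open>I\<close> plus the \<open>n\<close>-th power of the two-sided ideal generated
  by \<open>X\<close>. It is presented as a left ideal generated by products of at least \<open>n\<close> elements of \<open>X\<close>;
  multiplicativity below holds because coefficients can be moved to the left.\<close>

inductive_set odd_power :: "'a set \<Rightarrow> nat \<Rightarrow> 'a set" for X n where
  mem: "x \<in> I \<Longrightarrow> x \<in> odd_power X n"
| product: "\<lbrakk>set ds \<subseteq> X; n \<le> length ds\<rbrakk> \<Longrightarrow> r * prod_list ds \<in> odd_power X n"
| sum: "\<lbrakk>x \<in> odd_power X n; y \<in> odd_power X n\<rbrakk> \<Longrightarrow> x + y \<in> odd_power X n"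

lemma odd_power_0: "x \<in> odd_power X 0"
  using odd_power.product[of "[]" X 0 x] by simp

lemma odd_power_mult_left:
  assumes "x \<in> odd_power X n"
  shows "r * x \<in> odd_power X n"
  using assms
proof induction
  case (product ds r')
  then show ?case
    using odd_power.product[of ds X n "r * r'"] by (simp add: mult.assoc)
next
  case (sum x y)
  then show ?case by (simp add: distrib_left odd_power.sum)
qed (simp add: odd_power.mem mult_left_mem)

lemma odd_power_diff:
  "\<lbrakk>x \<in> odd_power X n; y \<in> odd_power X n\<rbrakk> \<Longrightarrow> x - y \<in> odd_power X n"
  using odd_power.sum[OF _ odd_power_mult_left[of y X n "- 1"]] by simp

lemma odd_power_mult:
  assumes X: "X \<subseteq> Od" and x: "x \<in> odd_power X m" and y: "y \<in> odd_power X n"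
  shows "x * y \<in> odd_power X (m + n)"
  using x
proof induction
  case (product ds r)
  note ds = product
  show ?case
    using y
  proof induction
    case (product ds' r')
    obtain s where s: "prod_list ds * r' - s * prod_list ds \<in> I"
      using odd_product_move[of ds r'] ds(1) X by blast
    have "r * (prod_list ds * r' - s * prod_list ds) * prod_list ds' \<in> odd_power X (m + n)"
      by (intro odd_power.mem mult_left_mem mult_right_mem s)
    moreover have "(r * s) * prod_list (ds @ ds') \<in> odd_power X (m + n)"
      by (rule odd_power.product) (use ds product in auto)
    ultimately have "r * (prod_list ds * r' - s * prod_list ds) * prod_list ds'
        + (r * s) * prod_list (ds @ ds') \<in> odd_power X (m + n)"
      by (rule odd_power.sum)
    then show ?case
      by (simp add: algebra_simps)
  qed (simp_all add: odd_power.mem mult_left_mem distrib_left odd_power.sum)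
qed (simp_all add: odd_power.mem mult_right_mem distrib_right odd_power.sum)

text \<open>Pigeonhole: a product of more than \<open>card X\<close> elements of \<open>X\<close> repeats a factor.\<close>

lemma odd_power_vanishes:
  assumes X: "X \<subseteq> Od" "finite X" "card X < n" and x: "x \<in> odd_power X n"
  shows "x \<in> I"
  using x
proof induction
  case (product ds r)
  have "\<not> distinct ds"
  proof
    assume "distinct ds"
    then have "length ds \<le> card X"
      using product(1) X(2) by (metis card_mono distinct_card)
    then show False using product(2) X(3) by simp
  qed
  then show ?case
    using product(1) X(1) by (intro mult_left_mem odd_product_repeated) auto
qed (auto intro: add_mem)

text \<open>A subring that contains every element whose odd summand lies in \<open>X\<close>. The summand from
  \<open>odd_power X 1\<close> need not be odd, so no parities have to be tracked in products: membership in
  the ideal generated by \<open>X\<close> is all that matters for commutators.\<close>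

definition even_plus_odd_span :: "'a set \<Rightarrow> 'a set" where
  "even_plus_odd_span X = {e + x | e x. e \<in> Ev \<and> x \<in> odd_power X 1}"

lemma even_plus_odd_span_add:
  assumes "p \<in> even_plus_odd_span X" and "q \<in> even_plus_odd_span X"
  shows "p + q \<in> even_plus_odd_span X"
proof -
  obtain e x where p: "e \<in> Ev" "x \<in> odd_power X 1" "p = e + x"
    using assms(1) by (auto simp: even_plus_odd_span_def)
  obtain e' x' where q: "e' \<in> Ev" "x' \<in> odd_power X 1" "q = e' + x'"
    using assms(2) by (auto simp: even_plus_odd_span_def)
  have "p + q = (e + e') + (x + x')" by (simp add: p q algebra_simps)
  then show ?thesis
    unfolding even_plus_odd_span_def using p q even_add odd_power.sum by blast
qed

lemma even_plus_odd_span_mult: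
  assumes X: "X \<subseteq> Od" and "p \<in> even_plus_odd_span X" and "q \<in> even_plus_odd_span X"
  shows "p * q \<in> even_plus_odd_span X"
proof -
  obtain e x where p: "e \<in> Ev" "x \<in> odd_power X 1" "p = e + x"
    using assms(2) by (auto simp: even_plus_odd_span_def)
  obtain e' x' where q: "e' \<in> Ev" "x' \<in> odd_power X 1" "q = e' + x'"
    using assms(3) by (auto simp: even_plus_odd_span_def)
  have "p * q = e * e' + (e * x' + x * q)"
    by (simp add: p q algebra_simps)
  moreover have "x * q \<in> odd_power X 1"
    using odd_power_mult[OF X p(2) odd_power_0[of q X]] by simp
  then have "e * x' + x * q \<in> odd_power X 1"
    by (rule odd_power.sum[OF odd_power_mult_left[OF q(2)]])
  ultimately show ?thesis
    unfolding even_plus_odd_span_def using p q even_mult by blast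
qed

text \<open>The even summands are central modulo \<open>I\<close>, so only the commutator of two elements of the ideal
  generated by \<open>X\<close> remains.\<close>

lemma comm2_in_odd_power:
  assumes X: "X \<subseteq> Od" and "p \<in> even_plus_odd_span X" and "q \<in> even_plus_odd_span X"
  shows "comm2 p q \<in> odd_power X 2"
proof -
  obtain e x where p: "e \<in> Ev" "x \<in> odd_power X 1" "p = e + x"
    using assms(2) by (auto simp: even_plus_odd_span_def)
  obtain e' x' where q: "e' \<in> Ev" "x' \<in> odd_power X 1" "q = e' + x'"
    using assms(3) by (auto simp: even_plus_odd_span_def)
  have "comm2 p q = (comm2 e q + comm2 x e') + (x * x' - x' * x)"
    by (simp add: p q comm2_def algebra_simps)
  moreover have "comm2 e q + comm2 x e' \<in> odd_power X 2"
    using p q by (intro odd_power.mem add_mem even_central even_central')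
  moreover have "x * x' - x' * x \<in> odd_power X 2"
    using odd_power_mult[OF X p(2) q(2)] odd_power_mult[OF X q(2) p(2)]
    by (intro odd_power_diff) (simp_all add: numeral_2_eq_2)
  ultimately show ?thesis by (simp add: odd_power.sum)
qed

text \<open>Each commutator contributes two factors from the ideal generated by \<open>X\<close>, whose power with
  exponent \<open>card X + 1\<close> vanishes modulo \<open>I\<close>.\<close>

theorem comm2_product_mem:
  assumes X: "X \<subseteq> Od" "finite X" "card X < 2 * length js"
    and p: "\<And>j. p j \<in> even_plus_odd_span X" and q: "\<And>j. q j \<in> even_plus_odd_span X"
  shows "(\<Prod>j\<leftarrow>js. comm2 (p j) (q j)) \<in> I"
proof -
  have "(\<Prod>j\<leftarrow>js. comm2 (p j) (q j)) \<in> odd_power X (2 * length js)"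
  proof (induction js)
    case Nil
    show ?case by (simp add: odd_power_0)
  next
    case (Cons j js)
    then show ?case
      using odd_power_mult[OF X(1) comm2_in_odd_power[OF X(1) p[of j] q[of j]]] by simp
  qed
  then show ?thesis
    by (rule odd_power_vanishes[OF X])
qed

end

section \<open>The Grassmann algebra\<close>

definition exterior_ideal :: "(nat, 'k::field) ncpoly set" where
  "exterior_ideal = Idl\<^bsub>free_algebra UNIV\<^esub>
     {v * v | v. \<forall>w \<in> Poly_Mapping.keys v. length (letters w) = 1}"

definition even_ncpolys :: "(nat, 'k::field) ncpoly set" where
  "even_ncpolys = {f. \<forall>w \<in> Poly_Mapping.keys f. even (length (letters w))}"

definition odd_ncpolys :: "(nat, 'k::field) ncpoly set" where
  "odd_ncpolys = {f. \<forall>w \<in> Poly_Mapping.keys f. odd (length (letters w))}"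

lemma grassmann_eq: "grassmann = quot_algebra (free_algebra UNIV) exterior_ideal"
  by (simp add: grassmann_def exterior_ideal_def)

lemma ideal_exterior_ideal: "ideal (exterior_ideal :: (nat, 'k::field) ncpoly set) (free_algebra UNIV)"
proof -
  interpret unital_algebra "free_algebra UNIV :: ('k, (nat, 'k) ncpoly) module"
    by (rule unital_algebra_free)
  show ?thesis
    unfolding exterior_ideal_def by (rule genideal_ideal) simp
qed

lemma exterior_ideal_closed:
  fixes f g :: "(nat, 'k::field) ncpoly"
  shows "0 \<in> (exterior_ideal :: (nat, 'k) ncpoly set)"
    and "\<lbrakk>f \<in> exterior_ideal; g \<in> exterior_ideal\<rbrakk> \<Longrightarrow> f + g \<in> exterior_ideal"
    and "f \<in> exterior_ideal \<Longrightarrow> g * f \<in> exterior_ideal"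
    and "f \<in> exterior_ideal \<Longrightarrow> f * g \<in> exterior_ideal"
    and "\<lbrakk>f \<in> exterior_ideal; g \<in> exterior_ideal\<rbrakk> \<Longrightarrow> f - g \<in> exterior_ideal"
proof -
  interpret ideal "exterior_ideal :: (nat, 'k) ncpoly set" "free_algebra UNIV"
    by (rule ideal_exterior_ideal)
  show "0 \<in> (exterior_ideal :: (nat, 'k) ncpoly set)"
    using additive_subgroup.zero_closed[OF is_additive_subgroup] by simp
  show add: "f + g \<in> exterior_ideal" if "f \<in> exterior_ideal" "g \<in> exterior_ideal" for f g :: "(nat, 'k) ncpoly"
    using additive_subgroup.a_closed[OF is_additive_subgroup, of f g] that by simp
  show left: "g * f \<in> exterior_ideal" if "f \<in> exterior_ideal" for f g :: "(nat, 'k) ncpoly"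
    using I_l_closed[of f g] that by simp
  show "f * g \<in> exterior_ideal" if "f \<in> exterior_ideal"
    using I_r_closed[of f g] that by simp
  show "f - g \<in> exterior_ideal" if "f \<in> exterior_ideal" "g \<in> exterior_ideal"
    using add[OF that(1) left[OF that(2), of "- 1"]] by simp
qed

text \<open>Polarization of the relation \<open>v * v = 0\<close> at \<open>v = e\<^sub>i + e\<^sub>j\<close>.\<close>

lemma letters_anticommute: "var i * var j + var j * var i \<in> (exterior_ideal :: (nat, 'k::field) ncpoly set)"
proof -
  interpret unital_algebra "free_algebra UNIV :: ('k, (nat, 'k) ncpoly) module"
    by (rule unital_algebra_free)
  have square: "v * v \<in> exterior_ideal"
    if "\<forall>w \<in> Poly_Mapping.keys v. length (letters w) = 1" for v :: "(nat, 'k) ncpoly"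
    using that genideal_self[of "{v * v | v. \<forall>w \<in> Poly_Mapping.keys v. length (letters w) = 1}"]
    unfolding exterior_ideal_def by auto
  let ?x = "var i :: (nat, 'k) ncpoly" and ?y = "var j :: (nat, 'k) ncpoly"
  have "(?x + ?y) * (?x + ?y) - ?x * ?x - ?y * ?y \<in> exterior_ideal"
    using keys_add[of ?x ?y] by (intro exterior_ideal_closed(5) square) (auto simp: var_def)
  then show ?thesis by (simp add: algebra_simps)
qed

abbreviation monomial :: "nat list \<Rightarrow> (nat, 'k::field) ncpoly" where
  "monomial u \<equiv> Poly_Mapping.single (Word u) 1"

lemma monomial_Cons: "monomial (i # u) = var i * monomial u"
  by (simp add: var_def mult_single plus_word_def)

lemma letter_monomial_swap:
  "var i * monomial v - (- 1) ^ length v * (monomial v * var i) \<in> exterior_ideal"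
proof (induction v)
  case Nil
  show ?case by (simp add: exterior_ideal_closed flip: zero_word_def)
next
  case (Cons j v)
  let ?s = "(- 1) ^ length v :: (nat, 'a) ncpoly"
  have "?s * var j = var j * ?s"
    by (cases "even (length v)") simp_all
  then have "var i * monomial (j # v) - (- 1) ^ length (j # v) * (monomial (j # v) * var i)
    = (var i * var j + var j * var i) * monomial v
      - var j * (var i * monomial v - ?s * (monomial v * var i))"
    unfolding monomial_Cons by (simp add: algebra_simps flip: mult.assoc)
  also have "\<dots> \<in> exterior_ideal"
    by (intro exterior_ideal_closed letters_anticommute Cons.IH)
  finally show ?case .
qed

lemma monomials_swap:
  "monomial u * monomial v - (- 1) ^ (length u * length v) * (monomial v * monomial u)
    \<in> exterior_ideal"
proof (induction u)
  case Nil
  show ?case by (simp add: exterior_ideal_closed flip: zero_word_def)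
next
  case (Cons i u)
  let ?s = "(- 1) ^ length v :: (nat, 'a) ncpoly"
  let ?t = "(- 1) ^ (length u * length v) :: (nat, 'a) ncpoly"
  have "?t * var i = var i * ?t"
    by (cases "even (length u * length v)") simp_all
  moreover have "?t * ?s = ?s * ?t"
    by (simp add: add.commute flip: power_add)
  ultimately have "monomial (i # u) * monomial v
      - (- 1) ^ (length (i # u) * length v) * (monomial v * monomial (i # u))
    = var i * (monomial u * monomial v - ?t * (monomial v * monomial u))
      + ?t * ((var i * monomial v - ?s * (monomial v * var i)) * monomial u)"
    unfolding monomial_Cons by (simp add: algebra_simps power_add flip: mult.assoc)
  also have "\<dots> \<in> exterior_ideal"
    by (intro exterior_ideal_closed Cons.IH letter_monomial_swap)
  finally show ?case .
qed

text \<open>Supercommutativity of homogeneous polynomials: \<open>n\<close> stands for the product of the two parities.\<close>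

lemma swap_bilinear:
  fixes f g :: "(nat, 'k::field) ncpoly" and n :: nat
  assumes parity: "\<And>u v. \<lbrakk>Word u \<in> Poly_Mapping.keys f; Word v \<in> Poly_Mapping.keys g\<rbrakk>
    \<Longrightarrow> even (length u * length v) = even n"
  shows "f * g - (- 1) ^ n * (g * f) \<in> exterior_ideal"
proof (induction f rule: ncpoly_induct)
  case (monomial w c)
  note w = this
  show ?case
  proof (induction g rule: ncpoly_induct)
    case (monomial w' d)
    obtain u v where uv: "w = Word u" "w' = Word v"
      by (cases w, cases w')
    let ?s = "(- 1) ^ n :: (nat, 'k) ncpoly"
    have sign: "(- 1 :: (nat, 'k) ncpoly) ^ (length u * length v) = ?s"
      using parity w monomial uv by (simp add: minus_one_power_iff)
    have "monomial u * monomial v - ?s * (monomial v * monomial u) \<in> exterior_ideal"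
      unfolding sign[symmetric] by (rule monomials_swap)
    then have "Poly_Mapping.single 0 (c * d)
        * (monomial u * monomial v - ?s * (monomial v * monomial u)) \<in> exterior_ideal"
      by (rule exterior_ideal_closed)
    then show ?case
      by (cases "even n") (simp_all add: uv right_diff_distrib distrib_left mult_single mult.commute)
  next
    case (add g h)
    then show ?case
      using exterior_ideal_closed(2)[OF add] by (simp add: algebra_simps)
  qed (simp add: exterior_ideal_closed)
next
  case (add f h)
  then show ?case
    using exterior_ideal_closed(2)[OF add] by (simp add: algebra_simps)
qed (simp add: exterior_ideal_closed)

lemma parity_decomposition:
  fixes f :: "(nat, 'k::field) ncpoly"
  shows "\<exists>e\<in>even_ncpolys. \<exists>d\<in>odd_ncpolys. f = e + d"
proof (induction f rule: ncpoly_induct)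
  case zero
  show ?case
    by (intro bexI[of _ 0]) (simp_all add: even_ncpolys_def odd_ncpolys_def)
next
  case (monomial w c)
  let ?m = "Poly_Mapping.single w c"
  show ?case
  proof (cases "even (length (letters w))")
    case True
    then have "?m \<in> even_ncpolys" "0 \<in> odd_ncpolys" by (simp_all add: even_ncpolys_def odd_ncpolys_def)
    then show ?thesis by force
  next
    case False
    then have "?m \<in> odd_ncpolys" "0 \<in> even_ncpolys" by (simp_all add: even_ncpolys_def odd_ncpolys_def)
    then show ?thesis by force
  qed
next
  case (add g h)
  then obtain e d e' d' where "e \<in> even_ncpolys" "d \<in> odd_ncpolys" "g = e + d"
    "e' \<in> even_ncpolys" "d' \<in> odd_ncpolys" "h = e' + d'"
    by blast
  moreover from this have "e + e' \<in> even_ncpolys" "d + d' \<in> odd_ncpolys"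
    using keys_add[of e e'] keys_add[of d d'] unfolding even_ncpolys_def odd_ncpolys_def by blast+
  moreover have "(e + d) + (e' + d') = (e + e') + (d + d')"
    by (simp add: algebra_simps)
  ultimately show ?case by metis
qed

lemma even_ncpolys_closed:
  fixes f g :: "(nat, 'k::field) ncpoly"
  shows "\<lbrakk>f \<in> even_ncpolys; g \<in> even_ncpolys\<rbrakk> \<Longrightarrow> f + g \<in> even_ncpolys"
    and "\<lbrakk>f \<in> even_ncpolys; g \<in> even_ncpolys\<rbrakk> \<Longrightarrow> f * g \<in> even_ncpolys"
    and "\<lbrakk>f \<in> odd_ncpolys; g \<in> odd_ncpolys\<rbrakk> \<Longrightarrow> comm2 f g \<in> even_ncpolys"
    and "Poly_Mapping.single 0 c \<in> (even_ncpolys :: (nat, 'k) ncpoly set)"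
proof -
  show sum: "f + g \<in> even_ncpolys" if "f \<in> even_ncpolys" "g \<in> even_ncpolys" for f g :: "(nat, 'k) ncpoly"
    using that keys_add[of f g] unfolding even_ncpolys_def by blast
  have mult: "f * g \<in> even_ncpolys"
    if "f \<in> even_ncpolys \<and> g \<in> even_ncpolys \<or> f \<in> odd_ncpolys \<and> g \<in> odd_ncpolys" for f g :: "(nat, 'k) ncpoly"
    unfolding even_ncpolys_def
  proof safe
    fix w assume "w \<in> Poly_Mapping.keys (f * g)"
    then obtain u v where "u \<in> Poly_Mapping.keys f" "v \<in> Poly_Mapping.keys g" "w = u + v"
      using keys_mult[of f g] by blast
    then show "even (length (letters w))"
      using that by (auto simp: even_ncpolys_def odd_ncpolys_def)
  qed
  show "f * g \<in> even_ncpolys" if "f \<in> even_ncpolys" "g \<in> even_ncpolys"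
    using that mult by blast
  show "comm2 f g \<in> even_ncpolys" if "f \<in> odd_ncpolys" "g \<in> odd_ncpolys"
  proof -
    have "- (g * f) \<in> even_ncpolys"
      using mult[of g f] that by (simp add: even_ncpolys_def keys_uminus_ncpoly)
    then show ?thesis
      using sum[of "f * g" "- (g * f)"] mult[of f g] that by (simp add: comm2_def)
  qed
  show "Poly_Mapping.single 0 c \<in> (even_ncpolys :: (nat, 'k) ncpoly set)"
    by (simp add: even_ncpolys_def)
qed

lemma even_ncpolys_central:
  fixes e f :: "(nat, 'k::field) ncpoly"
  assumes "e \<in> even_ncpolys"
  shows "comm2 e f \<in> exterior_ideal"
  using swap_bilinear[of e f 0] assms by (force simp: even_ncpolys_def comm2_def)

lemma odd_ncpolys_anticommute:
  fixes d d' :: "(nat, 'k::field) ncpoly"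
  assumes "d \<in> odd_ncpolys" and "d' \<in> odd_ncpolys"
  shows "d * d' + d' * d \<in> exterior_ideal"
  using swap_bilinear[of d d' 1] assms by (force simp: odd_ncpolys_def)

text \<open>Anticommutation of \<open>d\<close> with itself gives twice the square, and 2 is invertible.\<close>

lemma odd_ncpolys_square:
  fixes d :: "(nat, 'k::field_char_0) ncpoly"
  assumes "d \<in> odd_ncpolys"
  shows "d * d \<in> exterior_ideal"
proof -
  have "Poly_Mapping.single 0 (1 / 2) * (d * d + d * d) \<in> exterior_ideal"
    by (intro exterior_ideal_closed odd_ncpolys_anticommute assms)
  moreover have "Poly_Mapping.single 0 (1 / 2) + Poly_Mapping.single 0 (1 / 2) = (1 :: (nat, 'k) ncpoly)"
    by (simp flip: single_add)
  then have "Poly_Mapping.single 0 (1 / 2) * (d * d + d * d) = d * d"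
    by (metis distrib_left distrib_right mult_1)
  ultimately show ?thesis by simp
qed

interpretation grassmann: supercommutative_mod
  "exterior_ideal :: (nat, 'k::field_char_0) ncpoly set" even_ncpolys odd_ncpolys
  by unfold_locales
    (auto intro: exterior_ideal_closed even_ncpolys_closed even_ncpolys_central odd_ncpolys_anticommute
      odd_ncpolys_square parity_decomposition)

section \<open>Identities of relatively free Grassmann algebras\<close>

lemma polynomial_identity_rel_free_grassmannI:
  fixes f :: "(nat, 'k::field) ncpoly"
  assumes f: "f \<in> carrier (free_algebra {1..})"
    and vanishes: "\<And>\<beta> g. range g \<subseteq> carrier (free_algebra {1..k}) \<Longrightarrow>
      eval_poly (free_algebra UNIV) (\<lambda>i. eval_poly (free_algebra UNIV) \<beta> (g i)) f \<in> exterior_ideal"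
  shows "polynomial_identity (rel_free_algebra k grassmann) f"
proof -
  let ?R = "free_algebra UNIV :: ('k, (nat, 'k) ncpoly) module"
  let ?I = "exterior_ideal :: (nat, 'k) ncpoly set"
  have R: "unital_algebra ?R" by (rule unital_algebra_free)
  note quot = unital_algebra_quot[OF R ideal_exterior_ideal]
    eval_poly_quot[OF R ideal_exterior_ideal] coset_eq_zero_iff[OF R ideal_exterior_ideal]
  have "eval_poly (quot_algebra ?R ?I) (\<lambda>i. eval_poly (quot_algebra ?R ?I) a (g i)) f
      = \<zero>\<^bsub>quot_algebra ?R ?I\<^esub>"
    if a: "range a \<subseteq> carrier (quot_algebra ?R ?I)"
      and g: "range g \<subseteq> carrier (free_algebra {1..k})" for a g
  proof -
    obtain \<beta> where a_eq: "a = (+>\<^bsub>?R\<^esub>) ?I \<circ> \<beta>"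
      using lift_to_representatives[OF R ideal_exterior_ideal a] by blast
    have total: "range b \<subseteq> carrier ?R" for b :: "nat \<Rightarrow> (nat, 'k) ncpoly"
      by simp
    have "(\<lambda>i. eval_poly (quot_algebra ?R ?I) a (g i)) = (+>\<^bsub>?R\<^esub>) ?I \<circ> (\<lambda>i. eval_poly ?R \<beta> (g i))"
      unfolding a_eq quot(2)[OF total] by (simp add: comp_def)
    then show ?thesis
      using vanishes[OF g, of \<beta>] by (simp add: quot(2)[OF total] quot(3))
  qed
  then show ?thesis
    using f unfolding grassmann_eq polynomial_identity_rel_free_iff[OF quot(1)] by blast
qed

lemma eval_free_algebra:
  fixes b :: "nat \<Rightarrow> (nat, 'k::field) ncpoly"
  defines "E \<equiv> eval_poly (free_algebra UNIV) b"
  shows "E (var i) = b i" and "E (comm2 f g) = comm2 (E f) (E g)"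
    and "E (comm3 f g h) = comm3 (E f) (E g) (E h)" and "E (prod_list fs) = prod_list (map E fs)"
proof -
  interpret unital_algebra "free_algebra UNIV :: ('k, (nat, 'k) ncpoly) module"
    by (rule unital_algebra_free)
  have total: "range b \<subseteq> carrier (free_algebra UNIV)" by simp
  note E = eval_poly_var[OF total] eval_poly_mult[OF total] eval_poly_add[OF total]
    eval_poly_one[OF total]
  show "E (var i) = b i" by (simp add: E_def E)
  have diff: "E (f - g) = E f - E g" for f g
    using E(3)[of "f - g" g] by (simp add: E_def algebra_simps)
  show comm2: "E (comm2 f g) = comm2 (E f) (E g)" for f g
    by (simp add: comm2_def diff) (simp add: E_def E)
  show "E (comm3 f g h) = comm3 (E f) (E g) (E h)"
    by (simp add: comm3_def comm2)
  show "E (prod_list fs) = prod_list (map E fs)"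
    by (induction fs) (simp_all add: E_def E)
qed

lemma comm2_closed:
  "\<lbrakk>f \<in> carrier (free_algebra V); g \<in> carrier (free_algebra V)\<rbrakk>
    \<Longrightarrow> comm2 f g \<in> carrier (free_algebra V)"
  by (simp add: comm2_def free_algebra_closed)

theorem comm3_identity_rel_free_grassmann:
  assumes "1 \<le> i" "1 \<le> j" "1 \<le> l"
  shows "polynomial_identity (rel_free_algebra k (grassmann :: ('k::field_char_0, (nat, 'k) ncpoly set) module))
    (comm3 (var i) (var j) (var l))"
  by (rule polynomial_identity_rel_free_grassmannI)
    (use assms in \<open>simp_all add: comm3_def[of "var i"] comm2_closed var_closed,
      simp add: eval_free_algebra grassmann.comm3_mem flip: comm3_def\<close>)

text \<open>The set is a subring that contains the scalars, so it contains the subalgebra generated by the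
  elements \<open>\<beta> i\<close>.\<close>

lemma value_in_even_plus_odd_span:
  fixes \<beta> :: "nat \<Rightarrow> (nat, 'k::field_char_0) ncpoly"
  assumes X: "X \<subseteq> odd_ncpolys" and \<beta>: "\<And>i. i \<in> V \<Longrightarrow> \<beta> i \<in> grassmann.even_plus_odd_span X"
    and p: "p \<in> carrier (free_algebra V)"
  shows "eval_poly (free_algebra UNIV) \<beta> p \<in> grassmann.even_plus_odd_span X"
proof -
  interpret unital_algebra "free_algebra UNIV :: ('k, (nat, 'k) ncpoly) module"
    by (rule unital_algebra_free)
  have total: "range \<beta> \<subseteq> carrier (free_algebra UNIV)" by simp
  have scalar: "Poly_Mapping.single 0 c \<in> grassmann.even_plus_odd_span X" for c :: 'k
    using even_ncpolys_closed(4)[of c] grassmann.odd_power.mem[OF exterior_ideal_closed(1), of X 1]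
    unfolding grassmann.even_plus_odd_span_def by force
  show ?thesis
  proof (induction p rule: ncpoly_induct)
    case zero
    show ?case using scalar[of 0] by simp
  next
    case (monomial w c)
    then have "set (letters w) \<subseteq> V" using p by (auto simp: in_free_algebra_iff)
    moreover have "foldr (\<lambda>i q. \<beta> i * q) ys 1 \<in> grassmann.even_plus_odd_span X" if "set ys \<subseteq> V" for ys
      using that
    proof (induction ys)
      case Nil
      show ?case using scalar[of 1] by simp
    next
      case (Cons i ys)
      then show ?case by (simp add: grassmann.even_plus_odd_span_mult[OF X \<beta>])
    qed
    ultimately show ?case
      using grassmann.even_plus_odd_span_mult[OF X scalar]
      by (simp add: eval_poly_monomial[OF total] eval_word_def)
  next
    case (add f g)
    then show ?case
      by (simp add: eval_poly_add[OF total] grassmann.even_plus_odd_span_add)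
  qed
qed

text \<open>Lift \<open>k\<close> generators to the free algebra and let \<open>X\<close> consist of their odd summands, at most \<open>k\<close>
  many. All values of polynomials in the generators are even up to the ideal generated by \<open>X\<close>.\<close>

theorem comm2_product_identity_rel_free_grassmann:
  assumes len: "k < 2 * length js" and pos: "\<And>j. 1 \<le> s j" "\<And>j. 1 \<le> t j"
  shows "polynomial_identity (rel_free_algebra k (grassmann :: ('k::field_char_0, (nat, 'k) ncpoly set) module))
    (\<Prod>j\<leftarrow>js. comm2 (var (s j)) (var (t j)))"
proof (rule polynomial_identity_rel_free_grassmannI)
  show "(\<Prod>j\<leftarrow>js. comm2 (var (s j)) (var (t j))) \<in> carrier (free_algebra {1..})"
    by (rule prod_list_closed) (use pos in \<open>auto intro!: comm2_closed var_closed\<close>)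
next
  fix \<beta> g :: "nat \<Rightarrow> (nat, 'k) ncpoly"
  assume g: "range g \<subseteq> carrier (free_algebra {1..k})"
  have "\<forall>i. \<exists>e d. e \<in> even_ncpolys \<and> d \<in> odd_ncpolys \<and> \<beta> i = e + d"
    using parity_decomposition by blast
  then obtain e d where split: "\<And>i. e i \<in> even_ncpolys" "\<And>i. d i \<in> odd_ncpolys" "\<And>i. \<beta> i = e i + d i"
    by metis
  let ?X = "d ` {1..k}"
  have X: "?X \<subseteq> odd_ncpolys" "finite ?X" "card ?X < 2 * length js"
    using split(2) card_image_le[of "{1..k}" d] len by auto
  have "\<beta> i \<in> grassmann.even_plus_odd_span ?X" if "i \<in> {1..k}" for i
    using split grassmann.odd_power.product[of "[d i]" ?X 1 1] that
    unfolding grassmann.even_plus_odd_span_def by auto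
  then have "eval_poly (free_algebra UNIV) \<beta> (g i) \<in> grassmann.even_plus_odd_span ?X" for i
    using g by (intro value_in_even_plus_odd_span[OF X(1), where V = "{1..k}"]) auto
  then show "eval_poly (free_algebra UNIV) (\<lambda>i. eval_poly (free_algebra UNIV) \<beta> (g i))
      (\<Prod>j\<leftarrow>js. comm2 (var (s j)) (var (t j))) \<in> exterior_ideal"
    using grassmann.comm2_product_mem[OF X] by (simp add: eval_free_algebra comp_def)
qed

section \<open>Identities of the relatively free algebras of $UT_2(G)$\<close>

text \<open>Each polynomial is a product of two polynomials of the form treated for the Grassmann algebra.
  With \<open>m + 1\<close> commutators the bound \<open>k < 2 * (m + 1)\<close> is exactly \<open>k \<le> 2 * m + 1\<close>.\<close>

theorem lemma17:
  fixes m k :: nat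
    and F :: "('k::field_char_0, (nat, 'k) ncpoly set) module"
  assumes "1 \<le> m" and "1 \<le> k" and "k \<le> 2 * m + 1"
    and "F = rel_free_algebra k (UT2 (grassmann :: ('k, (nat, 'k) ncpoly set) module))"
  shows "polynomial_identity F
           (comm3 (var 1) (var 2) (var 3) * comm3 (var 4) (var 5) (var 6))
       \<and> polynomial_identity F
           (comm3 (var 1) (var 2) (var 3)
            * (\<Prod>i\<leftarrow>[0..<m + 1]. comm2 (var (2 * i + 4)) (var (2 * i + 5))))
       \<and> polynomial_identity F
           ((\<Prod>i\<leftarrow>[0..<m + 1]. comm2 (var (2 * i + 1)) (var (2 * i + 2)))
            * comm3 (var (2 * m + 3)) (var (2 * m + 4)) (var (2 * m + 5)))
       \<and> polynomial_identity F
           (\<Prod>i\<leftarrow>[0..<2 * m + 2]. comm2 (var (2 * i + 1)) (var (2 * i + 2)))"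
proof -
  let ?G = "grassmann :: ('k, (nat, 'k) ncpoly set) module"
  have G: "unital_algebra ?G"
    unfolding grassmann_eq by (rule unital_algebra_quot[OF unital_algebra_free ideal_exterior_ideal])
  note product = product_of_identities_rel_free_UT2[OF G, of k, folded assms(4)]
  note comm3 = comm3_identity_rel_free_grassmann
  have commutators: "polynomial_identity (rel_free_algebra k ?G)
      (\<Prod>i\<leftarrow>js. comm2 (var (2 * i + s)) (var (2 * i + t)))"
    if "1 \<le> s" "1 \<le> t" "length js = m + 1" for s t js
    using that assms(3) by (intro comm2_product_identity_rel_free_grassmann) auto
  have "[0..<2 * m + 2] = [0..<m + 1] @ [m + 1..<2 * m + 2]"
    using upt_add_eq_append[of 0 "m + 1" "m + 1"] by (simp add: mult_2)
  then have halves: "(\<Prod>i\<leftarrow>[0..<2 * m + 2]. comm2 (var (2 * i + 1)) (var (2 * i + 2)))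
    = (\<Prod>i\<leftarrow>[0..<m + 1]. comm2 (var (2 * i + 1)) (var (2 * i + 2)))
      * (\<Prod>i\<leftarrow>[m + 1..<2 * m + 2]. comm2 (var (2 * i + 1)) (var (2 * i + 2)) :: (nat, 'k) ncpoly)"
    by (simp only: map_append prod_list.append)
  show ?thesis
    unfolding halves by (intro conjI product comm3 commutators) simp_all
qed

end
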